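(* Let $\alpha,\beta,\gamma>-1$, $\alpha\ne\beta$ and $|\alpha-\beta|<1$, and let $B_{(n,m)}$ be the monic Jacobi–Piñeiro polynomials of type II, with step-line Jacobi matrix having entries $b,c,d$ as in the context. Then the semi-infinite matrix $P_{II}=(P_{II,k,l})_{k,l\in\mathbb N_0}$, with $P_{II,k,l}=0$ unless $k-2\le l\le k+1$ and, for $n=0,1,\dots$, $$P_{II,2n,2n+1}=\frac{B_{(n+1,n)}(1)}{B_{(n,n)}(1)},\qquad P_{II,2n+1,2n+2}=\frac{B_{(n+1,n+1)}(1)}{B_{(n+1,n)}(1)},$$ $$P_{II,2n,2n}=b_{n,n},\qquad P_{II,2n+1,2n+1}=b_{n+1,n},$$ $$P_{II,2n+2,2n+1}=\frac{B_{(n+1,n)}(1)}{B_{(n+1,n+1)}(1)}c_{n+1,n+1},\qquad P_{II,2n+1,2n}=\frac{B_{(n,n)}(1)}{B_{(n+1,n)}(1)}c_{n+1,n},$$ $$P_{II,2n+2,2n}=\frac{B_{(n,n)}(1)}{B_{(n+1,n+1)}(1)}d_{n+1,n+1},\qquad P_{II,2n+3,2n+1}=\frac{B_{(n+1,n)}(1)}{B_{(n+2,n+1)}(1)}d_{n+2,n+1},$$ is a multiple stochastic matrix of type II.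
   Context: The monic Jacobi–Piñeiro multiple orthogonal polynomials of type II $B_{(n,m)}$ are the monic polynomials of degree $n+m$ with $$\int_0^1B_{(n,m)}(x)x^{\alpha+j}(1-x)^\gamma\,dx=0,\ 0\le j\le n-1,\qquad\int_0^1B_{(n,m)}(x)x^{\beta+j}(1-x)^\gamma\,dx=0,\ 0\le j\le m-1.$$ On the step-line put $B^{(2n)}=B_{(n,n)}$ and $B^{(2n+1)}=B_{(n+1,n)}$, $n\in\mathbb N_0$. The Jacobi matrix $J=(J_{k,l})_{k,l\in\mathbb N_0}$ is defined by $xB^{(k)}(x)=\sum_lJ_{k,l}B^{(l)}(x)$; $J_{k,k+1}=1$ and $J_{k,l}=0$ unless $k-2\le l\le k+1$. Its remaining entries are denoted $b_{n,n}=J_{2n,2n}$, $b_{n+1,n}=J_{2n+1,2n+1}$, $c_{n+1,n}=J_{2n+1,2n}$, $c_{n+1,n+1}=J_{2n+2,2n+1}$, $d_{n+1,n+1}=J_{2n+2,2n}$, $d_{n+2,n+1}=J_{2n+3,2n+1}$. A multiple stochastic matrix of type II (here with two subdiagonals) is a semi-infinite matrix with nonnegative entries, each row summing to $1$, and $P_{k,l}=0$ unless $k-2\le l\le k+1$. *)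

theory Defs
  imports "HOL-Analysis.Analysis" "HOL-Computational_Algebra.Polynomial"
begin

(* Using has_integral (rather than an equation for the integral operator) avoids the
   default value 0 of the operator at non-integrable functions. For exponents greater
   than -1 the integrands below are absolutely integrable on [0,1]; their values at the
   end points, where 0 powr a = 0, are irrelevant. *)
definition is_jacobi_pineiro :: "real \<Rightarrow> real \<Rightarrow> real \<Rightarrow> nat \<Rightarrow> nat \<Rightarrow> real poly \<Rightarrow> bool" where
  "is_jacobi_pineiro \<alpha> \<beta> \<gamma> n m p \<longleftrightarrow>
     degree p = n + m \<and> lead_coeff p = 1 \<and>
     (\<forall>j<n. ((\<lambda>x. poly p x * x powr (\<alpha> + real j) * (1 - x) powr \<gamma>) has_integral 0) {0..1}) \<and>
     (\<forall>j<m. ((\<lambda>x. poly p x * x powr (\<beta> + real j) * (1 - x) powr \<gamma>) has_integral 0) {0..1})"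

definition jacobi_pineiro :: "real \<Rightarrow> real \<Rightarrow> real \<Rightarrow> nat \<Rightarrow> nat \<Rightarrow> real poly" where
  "jacobi_pineiro \<alpha> \<beta> \<gamma> n m = (THE p. is_jacobi_pineiro \<alpha> \<beta> \<gamma> n m p)"

(* Step-line: (n, n) for k = 2 * n, and (n + 1, n) for k = 2 * n + 1. *)
definition jacobi_pineiro_step :: "real \<Rightarrow> real \<Rightarrow> real \<Rightarrow> nat \<Rightarrow> real poly" where
  "jacobi_pineiro_step \<alpha> \<beta> \<gamma> k = jacobi_pineiro \<alpha> \<beta> \<gamma> ((k + 1) div 2) (k div 2)"

(* The row-finite matrix of multiplication by x with respect to the sequence Q; it is
   unique when Q is a basis, in particular when each Q k has degree k. The band structure
   is not built in: for the step-line polynomials it is a consequence of orthogonality. *)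
definition jacobi_matrix :: "(nat \<Rightarrow> real poly) \<Rightarrow> nat \<Rightarrow> nat \<Rightarrow> real" where
  "jacobi_matrix Q =
     (THE J. \<forall>k. finite {l. J k l \<noteq> 0} \<and>
                 [:0, 1:] * Q k = (\<Sum>l | J k l \<noteq> 0. smult (J k l) (Q l)))"

definition multiple_stochastic_II :: "(nat \<Rightarrow> nat \<Rightarrow> real) \<Rightarrow> bool" where
  "multiple_stochastic_II P \<longleftrightarrow>
     (\<forall>k l. 0 \<le> P k l) \<and>
     (\<forall>k. P k sums 1) \<and>
     (\<forall>k l. \<not> (k \<le> l + 2 \<and> l \<le> k + 1) \<longrightarrow> P k l = 0)"

end

theory Submission
  imports Defs
begin

text \<open>
  Consider, for a finite set \<open>A\<close> of exponents greater than \<open>-1\<close>, the monic polynomial \<open>p\<close> of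
  degree \<open>k = card A\<close> that is orthogonal to \<open>x\<^sup>a (1 - x)\<^sup>\<gamma>\<close> for all \<open>a \<in> A\<close>. By the functional
  equation of the Beta function, the integral of \<open>p x\<^sup>s (1 - x)\<^sup>\<gamma>\<close> is a positive multiple of
  \<open>q s\<close>, where \<open>q\<close> is a polynomial of degree at most \<open>k\<close> with \<open>k\<close>-th coefficient \<open>p 1\<close>.
  Orthogonality determines the zeros of \<open>q\<close>, so \<open>q s\<close> is \<open>p 1\<close> times the product of the \<open>s - a\<close>; evaluating at \<open>s = - (k + \<gamma> + 1)\<close> gives
  \<open>p 1 = (\<gamma> + 1)\<^sub>k / (\<Prod>a\<in>A. k + \<gamma> + 1 + a) > 0\<close>.

  If \<open>p\<close> and \<open>p'\<close> belong to \<open>S \<union> {a}\<close> and \<open>S \<union> {b}\<close>, then \<open>p - p'\<close> is a multiple of the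
  polynomial of \<open>S\<close>, and comparing values at \<open>1\<close> shows that the factor is nonnegative for
  \<open>a < b\<close>. Likewise, \<open>x\<close> times the polynomial of \<open>S + 1\<close> is that of \<open>S \<union> {c}\<close> plus a nonnegative
  multiple of that of \<open>S\<close>. On the step-line the exponents are \<open>\<alpha>, \<beta>, \<alpha> + 1, \<beta> + 1, \<dots>\<close>; sliding
  the window of the first \<open>k\<close> of them two places to the right and then multiplying by \<open>x\<close> writes
  the Jacobi matrix as a product of two lower and one upper bidiagonal matrix. Since
  \<open>\<bar>\<alpha> - \<beta>\<bar> < 1\<close>, their entries are nonnegative, with one possible exception that only affects the
  row \<open>k = 1\<close>.
\<close>

section \<open>Moments as polynomials in the exponent\<close>

lemma Beta_add_nat:
  fixes x y :: real
  assumes "x > 0" "y > 0"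
  shows "Beta (x + real j) y = pochhammer x j / pochhammer (x + y) j * Beta x y"
proof (induction j)
  case (Suc j)
  have "x + real j \<notin> \<int>\<^sub>\<le>\<^sub>0"
    using assms by (auto elim!: nonpos_Ints_cases)
  from Beta_plus1_left[OF this, of y]
  have "(x + y + real j) * Beta (x + real (Suc j)) y = (x + real j) * Beta (x + real j) y"
    by (simp add: algebra_simps)
  hence "Beta (x + real (Suc j)) y = (x + real j) / (x + y + real j) * Beta (x + real j) y"
    using assms by (simp add: field_simps)
  thus ?case
    by (simp add: Suc.IH pochhammer_Suc ac_simps)
qed auto

locale jacobi_exponent =
  fixes \<gamma> :: real
  assumes gamma: "\<gamma> > -1"
begin

text \<open>As a polynomial in \<open>s\<close>, this is the moment of \<open>x ^ j\<close> against
  \<open>x powr s * (1 - x) powr \<gamma>\<close>, divided by a factor that is the same for all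
  \<open>j \<le> k\<close>.\<close>

definition moment_basis :: "nat \<Rightarrow> nat \<Rightarrow> real poly" where
  "moment_basis k j = (\<Prod>i<j. [:1 + real i, 1:]) * (\<Prod>i\<in>{j..<k}. [:\<gamma> + 2 + real i, 1:])"

lemma degree_moment_basis:
  assumes "j \<le> k"
  shows "degree (moment_basis k j) = k"
  unfolding moment_basis_def using assms
  by (subst degree_mult_eq) (auto simp: degree_prod_eq_sum_degree)

lemma lead_coeff_moment_basis: "lead_coeff (moment_basis k j) = 1"
  unfolding moment_basis_def lead_coeff_mult lead_coeff_prod by simp

lemma poly_moment_basis:
  "poly (moment_basis k j) s = pochhammer (s + 1) j * (\<Prod>i\<in>{j..<k}. s + \<gamma> + 2 + real i)"
  by (simp add: moment_basis_def poly_prod pochhammer_prod atLeast0LessThan algebra_simps)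

text \<open>The node is the zero of the factor with index \<open>k - 1\<close>, which occurs in
  every basis element except the last.\<close>

lemma poly_moment_basis_shift:
  assumes "j \<le> k"
  shows "poly (moment_basis k j) (- (real k + \<gamma> + 1)) =
           (if j = k then (-1) ^ k * pochhammer (\<gamma> + 1) k else 0)"
proof (cases "j = k")
  case True
  have "pochhammer (- (real k + \<gamma> + 1) + 1) k = pochhammer (- (real k + \<gamma>)) k"
    by (simp add: algebra_simps)
  also have "\<dots> = (-1) ^ k * pochhammer (\<gamma> + 1) k"
    by (subst pochhammer_minus) (simp add: algebra_simps)
  finally show ?thesis
    using True by (simp add: poly_moment_basis)
next
  case False
  hence "k - 1 \<in> {j..<k}" "- (real k + \<gamma> + 1) + \<gamma> + 2 + real (k - 1) = 0"
    using assms by auto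
  hence "(\<Prod>i\<in>{j..<k}. - (real k + \<gamma> + 1) + \<gamma> + 2 + real i) = 0"
    by (intro prod_zero) (auto intro!: bexI[of _ "k - 1"])
  thus ?thesis
    using False by (simp add: poly_moment_basis)
qed

text \<open>A relation, so that integrability is part of the claim and a zero integral is never a
  default value.\<close>

definition jacobi_integral :: "real poly \<Rightarrow> real \<Rightarrow> real \<Rightarrow> bool" where
  "jacobi_integral p s I \<longleftrightarrow>
     ((\<lambda>x. poly p x * x powr s * (1 - x) powr \<gamma>) has_integral I) {0..1}"

lemma jacobi_integral_unique:
  "jacobi_integral p s I \<Longrightarrow> jacobi_integral p s I' \<Longrightarrow> I = I'"
  unfolding jacobi_integral_def by (rule has_integral_unique)

lemma jacobi_integral_add:
  "jacobi_integral p s I \<Longrightarrow> jacobi_integral r s I' \<Longrightarrow> jacobi_integral (p + r) s (I + I')"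
  unfolding jacobi_integral_def poly_add distrib_right by (rule has_integral_add)

lemma jacobi_integral_smult:
  "jacobi_integral p s I \<Longrightarrow> jacobi_integral (smult c p) s (c * I)"
  unfolding jacobi_integral_def using has_integral_mult_right[of _ I "{0..1}" c]
  by (simp add: mult.assoc)

lemma jacobi_integral_diff:
  "jacobi_integral p s I \<Longrightarrow> jacobi_integral r s I' \<Longrightarrow> jacobi_integral (p - r) s (I - I')"
  unfolding jacobi_integral_def poly_diff left_diff_distrib by (rule has_integral_diff)

lemma jacobi_integral_sum:
  assumes "\<And>j. j \<in> A \<Longrightarrow> jacobi_integral (f j) s (I j)"
  shows "jacobi_integral (\<Sum>j\<in>A. f j) s (\<Sum>j\<in>A. I j)"
  using assms
proof (induction A rule: infinite_finite_induct)
  case (insert x F)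
  thus ?case by (simp add: jacobi_integral_add)
qed (simp_all add: jacobi_integral_def)

lemma jacobi_integral_mult_x:
  "jacobi_integral (pCons 0 p) s I \<longleftrightarrow> jacobi_integral p (s + 1) I"
  unfolding jacobi_integral_def
proof (rule has_integral_cong)
  fix x :: real assume "x \<in> {0..1}"
  \<comment> \<open>This includes \<open>x = 0\<close>, where both sides are 0.\<close>
  hence "x * x powr s = x powr (s + 1)"
    by (simp add: powr_mult_base add.commute)
  thus "poly (pCons 0 p) x * x powr s * (1 - x) powr \<gamma> =
          poly p x * x powr (s + 1) * (1 - x) powr \<gamma>"
    by (simp add: mult.assoc mult.left_commute)
qed

lemma jacobi_integral_monom:
  assumes "s > -1" "j \<le> k"
  shows "jacobi_integral (monom 1 j) s
           (Beta (s + 1) (\<gamma> + 1) / pochhammer (s + \<gamma> + 2) k * poly (moment_basis k j) s)"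
proof -
  have int: "jacobi_integral (monom 1 j) s (Beta (s + real j + 1) (\<gamma> + 1))"
    using \<open>s > -1\<close>
  proof (induction j arbitrary: s)
    case 0
    show ?case
      using has_integral_Beta_real[of "s + 1" "\<gamma> + 1"] 0 gamma
      by (simp add: jacobi_integral_def)
  next
    case (Suc j)
    have "jacobi_integral (monom 1 j) (s + 1) (Beta (s + 1 + real j + 1) (\<gamma> + 1))"
      by (rule Suc.IH) (use Suc.prems in auto)
    thus ?case
      by (simp add: monom_Suc jacobi_integral_mult_x algebra_simps)
  qed
  \<comment> \<open>\<open>W\<close> extends the denominator belonging to \<open>j\<close> to the
    one belonging to \<open>k\<close>, which makes the prefactor independent of
    \<open>j\<close>.\<close>
  define W where "W = (\<Prod>i\<in>{j..<k}. s + \<gamma> + 2 + real i)"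
  have "{0..<k} = {0..<j} \<union> {j..<k}"
    using assms by auto
  hence "pochhammer (s + \<gamma> + 2) k = pochhammer (s + \<gamma> + 2) j * W"
    unfolding pochhammer_prod W_def by (simp add: prod.union_disjoint ivl_disj_int)
  moreover have "W > 0"
    unfolding W_def using assms gamma by (intro prod_pos) auto
  moreover have "Beta (s + real j + 1) (\<gamma> + 1) =
      pochhammer (s + 1) j / pochhammer (s + \<gamma> + 2) j * Beta (s + 1) (\<gamma> + 1)"
    using Beta_add_nat[of "s + 1" "\<gamma> + 1" j] assms gamma by (simp add: add_ac)
  ultimately have "Beta (s + real j + 1) (\<gamma> + 1) =
      Beta (s + 1) (\<gamma> + 1) / pochhammer (s + \<gamma> + 2) k * poly (moment_basis k j) s"
    by (simp add: poly_moment_basis flip: W_def)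
  thus ?thesis
    using int by simp
qed

text \<open>The value at the node \<open>- (k + \<gamma> + 1)\<close> recovers the leading coefficient of \<open>p\<close>: there all
  elements of the moment basis except the last one vanish.\<close>
lemma jacobi_integral_eq_poly:
  fixes p :: "real poly"
  obtains q where "degree q \<le> degree p" "coeff q (degree p) = poly p 1"
    "poly q (- (real (degree p) + \<gamma> + 1)) =
       (-1) ^ degree p * pochhammer (\<gamma> + 1) (degree p) * lead_coeff p"
    "\<And>s. s > -1 \<Longrightarrow> jacobi_integral p s
       (Beta (s + 1) (\<gamma> + 1) / pochhammer (s + \<gamma> + 2) (degree p) * poly q s)"
proof -
  define k where "k = degree p"
  define q where "q = (\<Sum>j\<le>k. smult (coeff p j) (moment_basis k j))"
  have p: "p = (\<Sum>j\<le>k. smult (coeff p j) (monom 1 j))"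
    by (simp add: smult_monom k_def poly_as_sum_of_monoms)
  show ?thesis
  proof
    show "degree q \<le> degree p"
      unfolding q_def by (intro degree_sum_le) (auto simp: degree_moment_basis k_def)
    have "coeff (moment_basis k j) k = 1" if "j \<le> k" for j
      using lead_coeff_moment_basis[of k j] degree_moment_basis[OF that] by simp
    thus "coeff q (degree p) = poly p 1"
      by (simp add: q_def coeff_sum poly_altdef k_def)
    have "poly q (- (real k + \<gamma> + 1)) =
            (\<Sum>j\<le>k. coeff p j * (if j = k then (-1) ^ k * pochhammer (\<gamma> + 1) k else 0))"
      unfolding q_def poly_sum poly_smult
      by (intro sum.cong refl) (subst poly_moment_basis_shift, auto)
    also have "\<dots> = (\<Sum>j\<le>k. if j = k then coeff p k * ((-1) ^ k * pochhammer (\<gamma> + 1) k) else 0)"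
      by (intro sum.cong) auto
    finally show "poly q (- (real (degree p) + \<gamma> + 1)) =
        (-1) ^ degree p * pochhammer (\<gamma> + 1) (degree p) * lead_coeff p"
      by (simp add: k_def)
    fix s :: real assume s: "s > -1"
    let ?c = "Beta (s + 1) (\<gamma> + 1) / pochhammer (s + \<gamma> + 2) k"
    have "jacobi_integral (\<Sum>j\<le>k. smult (coeff p j) (monom 1 j)) s
            (\<Sum>j\<le>k. coeff p j * (?c * poly (moment_basis k j) s))"
      using s by (intro jacobi_integral_sum jacobi_integral_smult jacobi_integral_monom) auto
    moreover have "(\<Sum>j\<le>k. coeff p j * (?c * poly (moment_basis k j) s)) = ?c * poly q s"
      unfolding q_def poly_sum poly_smult sum_distrib_left by (intro sum.cong) auto
    ultimately show "jacobi_integral p s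
        (Beta (s + 1) (\<gamma> + 1) / pochhammer (s + \<gamma> + 2) (degree p) * poly q s)"
      using p k_def by metis
  qed
qed

lemma pochhammer_gamma_pos: "pochhammer (\<gamma> + 1) k > 0"
  using gamma by (intro pochhammer_pos) auto

lemma moment_factor_pos:
  "s > -1 \<Longrightarrow> Beta (s + 1) (\<gamma> + 1) / pochhammer (s + \<gamma> + 2) k > 0"
  using gamma by (intro divide_pos_pos pochhammer_pos) (auto simp: Beta_def Gamma_real_pos)

text \<open>Vanishing moments are roots of \<open>q\<close>, and \<open>q\<close> is nonzero because
  its value at the node is a nonzero multiple of the leading coefficient of
  \<open>p\<close>.\<close>

lemma card_jacobi_zeros_le:
  assumes "p \<noteq> 0" "finite A" "\<forall>s\<in>A. s > -1 \<and> jacobi_integral p s 0"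
  shows "card A \<le> degree p"
proof -
  obtain q where q: "degree q \<le> degree p"
    "poly q (- (real (degree p) + \<gamma> + 1)) =
       (-1) ^ degree p * pochhammer (\<gamma> + 1) (degree p) * lead_coeff p"
    "\<And>s. s > -1 \<Longrightarrow> jacobi_integral p s
       (Beta (s + 1) (\<gamma> + 1) / pochhammer (s + \<gamma> + 2) (degree p) * poly q s)"
    using jacobi_integral_eq_poly[of p] by metis
  have "q \<noteq> 0"
    using q(2) assms(1) pochhammer_gamma_pos[of "degree p"] by auto
  have "poly q s = 0" if "s \<in> A" for s
  proof -
    have "s > -1" "jacobi_integral p s 0"
      using assms(3) that by auto
    hence "Beta (s + 1) (\<gamma> + 1) / pochhammer (s + \<gamma> + 2) (degree p) * poly q s = 0"
      using q(3) jacobi_integral_unique by metis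
    thus ?thesis
      using moment_factor_pos[OF \<open>s > -1\<close>, of "degree p"] by auto
  qed
  hence "card A \<le> card {x. poly q x = 0}"
    by (intro card_mono poly_roots_finite \<open>q \<noteq> 0\<close>) auto
  also have "\<dots> \<le> degree q"
    by (rule card_poly_roots_bound[OF \<open>q \<noteq> 0\<close>])
  finally show ?thesis
    using q(1) by simp
qed

section \<open>Orthogonal polynomials for a finite set of exponents\<close>

text \<open>Every exponent counts as a weight of its own, so conditions from the two families
  \<alpha> + j and \<beta> + j are treated alike.\<close>

definition mop :: "real set \<Rightarrow> real poly \<Rightarrow> bool" where
  "mop A p \<longleftrightarrow> degree p = card A \<and> coeff p (card A) = 1 \<and> (\<forall>s\<in>A. jacobi_integral p s 0)"

definition exponents :: "real set \<Rightarrow> bool" where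
  "exponents A \<longleftrightarrow> finite A \<and> (\<forall>s\<in>A. s > -1)"

lemma exponents_insert [simp]: "exponents (insert a A) \<longleftrightarrow> a > -1 \<and> exponents A"
  by (auto simp: exponents_def)

lemma exponents_shift: "exponents A \<Longrightarrow> exponents ((+) 1 ` A)"
  by (force simp: exponents_def)

text \<open>The coefficient of degree \<open>card S\<close> cancels in the difference of the two
  sides; if nonzero, the difference would have too small a degree for its \<open>card S\<close>
  vanishing moments.\<close>

lemma mop_span:
  assumes "exponents S" "mop S r" "degree p \<le> card S" "\<forall>s\<in>S. jacobi_integral p s 0"
  shows "p = smult (coeff p (card S)) r"
proof (rule ccontr)
  let ?d = "p - smult (coeff p (card S)) r"
  assume "p \<noteq> smult (coeff p (card S)) r"
  hence nz: "?d \<noteq> 0" by simp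
  have "\<forall>s\<in>S. s > -1 \<and> jacobi_integral ?d s 0"
    using assms jacobi_integral_diff[OF _ jacobi_integral_smult, of p _ 0 r 0]
    by (auto simp: exponents_def mop_def)
  hence "card S \<le> degree ?d"
    using assms nz by (intro card_jacobi_zeros_le) (auto simp: exponents_def)
  moreover have "degree ?d \<le> card S"
    using assms by (intro degree_diff_le order.trans[OF degree_smult_le]) (auto simp: mop_def)
  moreover have "coeff ?d (card S) = 0"
    using assms(2) by (simp add: mop_def)
  ultimately have "lead_coeff ?d = 0"
    by (metis le_antisym)
  with nz show False by (simp only: leading_coeff_0_iff)
qed

lemma mop_unique: "exponents A \<Longrightarrow> mop A p \<Longrightarrow> mop A r \<Longrightarrow> p = r"
  using mop_span[of A r p] by (auto simp: mop_def)

text \<open>Both parts follow from the factorisation of \<open>q\<close> over \<open>A\<close>: the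
  first by evaluation at the node, the second because \<open>q\<close> has no roots outside
  \<open>A\<close>.\<close>

lemma mop_eval_1_and_zeros:
  assumes A: "exponents A" and p: "mop A p"
  shows "poly p 1 * (\<Prod>a\<in>A. real (card A) + \<gamma> + 1 + a) = pochhammer (\<gamma> + 1) (card A)"
    and "s > -1 \<Longrightarrow> s \<notin> A \<Longrightarrow> \<not> jacobi_integral p s 0"
proof -
  define k where "k = card A"
  have deg: "degree p = k" "lead_coeff p = 1"
    using p by (auto simp: mop_def k_def)
  obtain q where q: "degree q \<le> k" "coeff q k = poly p 1"
    "poly q (- (real k + \<gamma> + 1)) = (-1) ^ k * pochhammer (\<gamma> + 1) k"
    "\<And>s. s > -1 \<Longrightarrow> jacobi_integral p s
       (Beta (s + 1) (\<gamma> + 1) / pochhammer (s + \<gamma> + 2) k * poly q s)"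
    using jacobi_integral_eq_poly[of p] deg by (metis mult.right_neutral)
  have zero_iff: "poly q s = 0 \<longleftrightarrow> jacobi_integral p s 0" if "s > -1" for s
  proof -
    let ?c = "Beta (s + 1) (\<gamma> + 1) / pochhammer (s + \<gamma> + 2) k"
    have "?c > 0" by (rule moment_factor_pos[OF that])
    moreover have "jacobi_integral p s (?c * poly q s)" by (rule q(4)[OF that])
    ultimately show ?thesis
      by (metis jacobi_integral_unique less_irrefl mult_eq_0_iff)
  qed
  define w where "w = (\<Prod>a\<in>A. [:- a, 1:])"
  have w: "degree w = k" "lead_coeff w = 1"
    unfolding w_def lead_coeff_prod by (simp_all add: degree_prod_eq_sum_degree k_def)
  \<comment> \<open>The \<open>k\<close>-th coefficients agree, so a nonzero difference would have
    degree below \<open>k\<close>, yet all \<open>k\<close> elements of \<open>A\<close> as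
    roots.\<close>
  have q_eq: "q = smult (poly p 1) w"
  proof (rule ccontr)
    let ?d = "q - smult (poly p 1) w"
    assume "q \<noteq> smult (poly p 1) w"
    hence nz: "?d \<noteq> 0" by simp
    have "poly ?d a = 0" if "a \<in> A" for a
    proof -
      have "poly q a = 0"
        using zero_iff[of a] A p that by (auto simp: exponents_def mop_def)
      moreover have "poly w a = 0"
        unfolding w_def poly_prod using A that
        by (intro prod_zero) (auto simp: exponents_def)
      ultimately show ?thesis by simp
    qed
    hence "k \<le> card {x. poly ?d x = 0}"
      unfolding k_def by (intro card_mono poly_roots_finite nz) auto
    also have "\<dots> \<le> degree ?d"
      by (rule card_poly_roots_bound[OF nz])
    finally have "k \<le> degree ?d" .
    moreover have "degree ?d \<le> k"
      using q(1) w(1) by (intro degree_diff_le order.trans[OF degree_smult_le]) auto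
    moreover have "coeff ?d k = 0"
      using q(2) w by simp
    ultimately have "lead_coeff ?d = 0"
      by (metis le_antisym)
    with nz show False by (simp only: leading_coeff_0_iff)
  qed
  have "(\<Prod>a\<in>A. - (real k + \<gamma> + 1) - a) = (\<Prod>a\<in>A. (-1) * (real k + \<gamma> + 1 + a))"
    by (intro prod.cong) auto
  also have "\<dots> = (-1) ^ k * (\<Prod>a\<in>A. real k + \<gamma> + 1 + a)"
    by (simp only: prod.distrib prod_constant k_def)
  finally have "poly w (- (real k + \<gamma> + 1)) = (-1) ^ k * (\<Prod>a\<in>A. real k + \<gamma> + 1 + a)"
    by (simp add: w_def poly_prod)
  with q(3) have "(-1) ^ k * (poly p 1 * (\<Prod>a\<in>A. real k + \<gamma> + 1 + a)) =
                    (-1) ^ k * pochhammer (\<gamma> + 1) k"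
    by (simp add: q_eq)
  thus *: "poly p 1 * (\<Prod>a\<in>A. real (card A) + \<gamma> + 1 + a) = pochhammer (\<gamma> + 1) (card A)"
    by (simp add: k_def)
  assume s: "s > -1" "s \<notin> A"
  have "poly p 1 \<noteq> 0"
    using * pochhammer_gamma_pos[of "card A"] by auto
  moreover have "poly w s \<noteq> 0"
    using s A by (auto simp: w_def poly_prod exponents_def)
  ultimately have "poly q s \<noteq> 0"
    by (simp add: q_eq)
  thus "\<not> jacobi_integral p s 0"
    using zero_iff[OF s(1)] by simp
qed

text \<open>The element \<open>a\<close> forces \<open>card A\<close> to be at least 1, which
  outweighs \<open>a > -1\<close>.\<close>

lemma factor_pos:
  assumes "finite A" "a \<in> A" "a > -1"
  shows "real (card A) + \<gamma> + 1 + a > 0"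
proof -
  have "card A > 0" using assms by (auto simp: card_gt_0_iff)
  thus ?thesis using assms gamma by linarith
qed

lemma mop_eval_1_eq:
  assumes "exponents A" "mop A p"
  shows "poly p 1 = pochhammer (\<gamma> + 1) (card A) / (\<Prod>a\<in>A. real (card A) + \<gamma> + 1 + a)"
proof -
  have "(\<Prod>a\<in>A. real (card A) + \<gamma> + 1 + a) > 0"
    using assms factor_pos by (intro prod_pos) (auto simp: exponents_def)
  thus ?thesis using mop_eval_1_and_zeros(1)[OF assms] by (simp add: field_simps)
qed

lemma mop_eval_1_pos:
  assumes "exponents A" "mop A p"
  shows "poly p 1 > 0"
  unfolding mop_eval_1_eq[OF assms] using assms factor_pos pochhammer_gamma_pos
  by (intro divide_pos_pos prod_pos) (auto simp: exponents_def)

lemma card_shift: "card ((+) 1 ` A) = card (A :: real set)"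
  by (intro card_image) auto

text \<open>With \<open>r\<close> belonging to the shifted set, \<open>x\<close> times
  \<open>r\<close> is orthogonal for all exponents in \<open>S\<close>. Subtracting a multiple of
  \<open>p\<close> also removes the moment at \<open>a\<close>; this is possible since the moment of
  \<open>p\<close> there is nonzero.\<close>

lemma mop_exists: "exponents A \<Longrightarrow> \<exists>p. mop A p"
proof (induction "card A" arbitrary: A)
  case 0
  hence "A = {}" by (simp add: exponents_def)
  thus ?case by (intro exI[of _ 1]) (simp add: mop_def)
next
  case (Suc k)
  then obtain a S where AS: "A = insert a S" "a \<notin> S"
    by (metis card_eq_SucD)
  have S: "exponents S" "a > -1" "card S = k"
    using Suc AS by (auto simp: exponents_def)
  obtain p where p: "mop S p" using Suc(1)[of S] S by auto
  obtain r where r: "mop ((+) 1 ` S) r"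
    using Suc(1)[of "(+) 1 ` S"] exponents_shift S card_shift by metis
  obtain I I' where I: "jacobi_integral p a I" "jacobi_integral r (a + 1) I'"
    using jacobi_integral_eq_poly S(2)
    by (metis add.commute less_add_one order_less_trans)
  have "I \<noteq> 0" using mop_eval_1_and_zeros(2)[OF S(1) p S(2) AS(2)] I(1) by auto
  define b where "b = pCons 0 r - smult (I' / I) p"
  have r0: "r \<noteq> 0" and pd: "degree p = k" and rd: "degree r = k"
    using p r S by (auto simp: mop_def card_shift)
  have "degree (smult (I' / I) p) < degree (pCons 0 r)"
    using degree_smult_le[of "I' / I" p] r0 pd rd by simp
  hence deg: "degree b = Suc k"
    using degree_add_eq_left[of "- smult (I' / I) p" "pCons 0 r"] r0 rd
    by (simp add: b_def)
  have "coeff r k = 1"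
    using r S(3) by (simp add: mop_def card_shift)
  hence lc: "lead_coeff b = 1"
    using pd deg by (simp add: b_def coeff_eq_0)
  have "jacobi_integral b s 0" if "s \<in> S" for s
  proof -
    have "jacobi_integral (pCons 0 r) s 0"
      using r that by (auto simp: mop_def jacobi_integral_mult_x add.commute)
    moreover have "jacobi_integral (smult (I' / I) p) s (I' / I * 0)"
      using p that by (intro jacobi_integral_smult) (auto simp: mop_def)
    ultimately show ?thesis
      unfolding b_def using jacobi_integral_diff by fastforce
  qed
  moreover have "jacobi_integral b a 0"
    using jacobi_integral_diff[of "pCons 0 r" a I' "smult (I' / I) p" "I' / I * I"]
      jacobi_integral_smult[OF I(1), of "I' / I"] I(2) \<open>I \<noteq> 0\<close>
    by (simp add: jacobi_integral_mult_x b_def)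
  ultimately have "mop A b"
    using deg lc AS Suc(2) unfolding mop_def by auto
  thus ?case by blast
qed

section \<open>Connection formulas with nonnegative coefficients\<close>

text \<open>The sign comes from the closed form of the values at 1: the denominators differ in a
  single factor, which is larger for \<open>b\<close>.\<close>

lemma mop_replace:
  assumes S: "exponents S" "a \<notin> S" "b \<notin> S" "a > -1" "a < b"
    and "mop (insert a S) p" "mop (insert b S) p'" "mop S r"
  shows "\<exists>l\<ge>0. p = p' + smult l r"
proof -
  define k where "k = card S"
  define l where "l = coeff (p - p') k"
  have fin: "finite S" using S by (simp add: exponents_def)
  have "b > -1" using S by simp
  have "degree p = Suc k" "degree p' = Suc k" "coeff p (Suc k) = 1" "coeff p' (Suc k) = 1"
    using assms fin by (auto simp: mop_def k_def)
  hence "degree (p - p') \<le> Suc k" "coeff (p - p') (Suc k) = 0"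
    by (auto intro: degree_diff_le)
  hence "degree (p - p') \<le> k"
    by (metis Suc_leI coeff_0 degree_0 leading_coeff_0_iff le_SucE le0)
  moreover have "\<forall>s\<in>S. jacobi_integral (p - p') s 0"
    using assms jacobi_integral_diff[of p _ 0 p' 0] by (auto simp: mop_def)
  ultimately have eq: "p - p' = smult l r"
    unfolding l_def k_def using mop_span[OF S(1) assms(8)] by blast
  define D where "D = (\<Prod>s\<in>S. real (Suc k) + \<gamma> + 1 + s)"
  have "D > 0"
    unfolding D_def using S gamma by (intro prod_pos) (auto simp: exponents_def algebra_simps)
  have pos: "real (Suc k) + \<gamma> + 1 + a > 0" "real (Suc k) + \<gamma> + 1 + b > 0"
    using S gamma by auto
  have "poly p 1 = pochhammer (\<gamma> + 1) (Suc k) / ((real (Suc k) + \<gamma> + 1 + a) * D)"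
    "poly p' 1 = pochhammer (\<gamma> + 1) (Suc k) / ((real (Suc k) + \<gamma> + 1 + b) * D)"
    using mop_eval_1_eq[OF _ assms(6)] mop_eval_1_eq[OF _ assms(7)] S fin \<open>b > -1\<close>
    by (simp_all add: D_def k_def)
  moreover have "pochhammer (\<gamma> + 1) (Suc k) / ((real (Suc k) + \<gamma> + 1 + b) * D) \<le>
      pochhammer (\<gamma> + 1) (Suc k) / ((real (Suc k) + \<gamma> + 1 + a) * D)"
    using pos \<open>D > 0\<close> \<open>a < b\<close> pochhammer_gamma_pos[of "Suc k"]
    by (intro divide_left_mono mult_right_mono mult_pos_pos) auto
  ultimately have "poly p' 1 \<le> poly p 1" by simp
  hence "l * poly r 1 \<ge> 0"
    using arg_cong[OF eq, of "\<lambda>f. poly f 1"] by simp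
  hence "l \<ge> 0"
    using mop_eval_1_pos[OF S(1) assms(8)] by (simp add: zero_le_mult_iff)
  moreover have "p = p' + smult l r"
    using eq by (simp add: algebra_simps)
  ultimately show ?thesis by blast
qed

text \<open>The value of \<open>p'\<close> at 1 is that of \<open>p\<close> times
  \<open>(\<gamma> + 1 + k) / (k + \<gamma> + 2 + c)\<close>, which is at most 1 because
  \<open>c > -1\<close>.\<close>

lemma mop_mult_x:
  assumes S: "exponents S" "c \<notin> S" "c > -1"
    and "mop ((+) 1 ` S) p" "mop (insert c S) p'" "mop S r"
  shows "\<exists>u\<ge>0. pCons 0 p = p' + smult u r"
proof -
  define k where "k = card S"
  define u where "u = coeff (pCons 0 p - p') k"
  have fin: "finite S" using S by (simp add: exponents_def)
  have deg: "degree p = k" "degree p' = Suc k" "coeff p k = 1" "coeff p' (Suc k) = 1"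
    using assms fin by (auto simp: mop_def k_def card_shift)
  hence "degree (pCons 0 p - p') \<le> Suc k" "coeff (pCons 0 p - p') (Suc k) = 0"
    by (auto intro!: degree_diff_le order.trans[OF degree_pCons_le])
  hence "degree (pCons 0 p - p') \<le> k"
    by (metis Suc_leI coeff_0 degree_0 leading_coeff_0_iff le_SucE le0)
  moreover have "\<forall>s\<in>S. jacobi_integral (pCons 0 p - p') s 0"
    using assms jacobi_integral_diff[of "pCons 0 p" _ 0 p' 0]
    by (auto simp: mop_def jacobi_integral_mult_x add.commute)
  ultimately have eq: "pCons 0 p - p' = smult u r"
    unfolding u_def k_def using mop_span[OF S(1) assms(6)] by blast
  define D where "D = (\<Prod>s\<in>S. real (Suc k) + \<gamma> + 1 + s)"
  have "D > 0"
    unfolding D_def using S gamma by (intro prod_pos) (auto simp: exponents_def algebra_simps)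
  have pos: "real (Suc k) + \<gamma> + 1 + c > 0" using S gamma by auto
  \<comment> \<open>Raising the exponents by 1 makes up for the degree of \<open>p\<close> being
    lower by 1, so the same product \<open>D\<close> occurs in both values.\<close>
  have "(\<Prod>a\<in>(+) 1 ` S. real k + \<gamma> + 1 + a) = D"
    unfolding D_def by (subst prod.reindex) (auto simp: add_ac)
  hence "poly p 1 = pochhammer (\<gamma> + 1) k / D"
    using mop_eval_1_eq[OF exponents_shift assms(4)] S by (simp add: card_shift k_def)
  moreover have "poly p' 1 = pochhammer (\<gamma> + 1) (Suc k) / ((real (Suc k) + \<gamma> + 1 + c) * D)"
    using mop_eval_1_eq[OF _ assms(5)] S fin by (simp add: D_def k_def)
  moreover have "pochhammer (\<gamma> + 1) (Suc k) / ((real (Suc k) + \<gamma> + 1 + c) * D) =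
      pochhammer (\<gamma> + 1) k / D * ((\<gamma> + 1 + real k) / (real (Suc k) + \<gamma> + 1 + c))"
    by (simp add: pochhammer_Suc)
  moreover have "pochhammer (\<gamma> + 1) k / D * ((\<gamma> + 1 + real k) / (real (Suc k) + \<gamma> + 1 + c))
      \<le> pochhammer (\<gamma> + 1) k / D * 1"
    using pos S \<open>D > 0\<close> pochhammer_gamma_pos[of k] by (intro mult_left_mono) auto
  ultimately have "poly p' 1 \<le> poly p 1" by simp
  hence "u * poly r 1 \<ge> 0"
    using arg_cong[OF eq, of "\<lambda>f. poly f 1"] by simp
  hence "u \<ge> 0"
    using mop_eval_1_pos[OF S(1) assms(6)] by (simp add: zero_le_mult_iff)
  moreover have "pCons 0 p = p' + smult u r"
    using eq by (simp add: algebra_simps)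
  ultimately show ?thesis by blast
qed

end


section \<open>Uniqueness of the matrix of multiplication by x\<close>

text \<open>In degree \<open>m\<close>, the largest index with a nonzero coefficient, only one
  summand contributes.\<close>

lemma sum_smult_eq_0D:
  fixes Q :: "nat \<Rightarrow> 'a :: idom poly"
  assumes Q: "\<And>k. degree (Q k) = k" "\<And>k. Q k \<noteq> 0"
    and "finite F" "(\<Sum>l\<in>F. smult (c l) (Q l)) = 0" "l \<in> F"
  shows "c l = 0"
proof (rule ccontr)
  assume "c l \<noteq> 0"
  define G where "G = {l \<in> F. c l \<noteq> 0}"
  have G: "finite G" "G \<noteq> {}"
    using assms \<open>c l \<noteq> 0\<close> by (auto simp: G_def)
  define m where "m = Max G"
  have m: "m \<in> F" "c m \<noteq> 0"
    using Max_in[OF G] by (auto simp: G_def m_def)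
  have "c l * coeff (Q l) m = 0" if "l \<in> F - {m}" for l
  proof (cases "c l = 0")
    case False
    hence "l < m"
      using that Max_ge[OF G(1), of l] by (auto simp: G_def m_def)
    thus ?thesis using Q(1) by (simp add: coeff_eq_0)
  qed auto
  hence "(\<Sum>l\<in>F - {m}. c l * coeff (Q l) m) = 0"
    by (intro sum.neutral ballI)
  hence "coeff (\<Sum>l\<in>F. smult (c l) (Q l)) m = c m * coeff (Q m) m"
    using assms(3) m by (simp add: coeff_sum sum.remove[of F m])
  moreover have "coeff (Q m) m \<noteq> 0"
    using Q by (metis leading_coeff_0_iff)
  ultimately show False
    using assms(4) m by simp
qed

text \<open>Reduces the definite description to exhibiting one matrix: two candidate rows, summed
  over a common finite index set, agree by linear independence.\<close>

lemma jacobi_matrix_eqI: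
  assumes Q: "\<And>k. degree (Q k) = k" "\<And>k. Q k \<noteq> 0"
    and fin: "\<And>k. finite {l. J k l \<noteq> 0}"
    and eq: "\<And>k. [:0, 1:] * Q k = (\<Sum>l | J k l \<noteq> 0. smult (J k l) (Q l))"
  shows "jacobi_matrix Q = J"
  unfolding jacobi_matrix_def
proof (rule the_equality)
  fix J' :: "nat \<Rightarrow> nat \<Rightarrow> real"
  assume *: "\<forall>k. finite {l. J' k l \<noteq> 0} \<and>
               [:0, 1:] * Q k = (\<Sum>l | J' k l \<noteq> 0. smult (J' k l) (Q l))"
  show "J' = J"
  proof (intro ext)
    fix k l
    define F where "F = insert l ({l. J k l \<noteq> 0} \<union> {l. J' k l \<noteq> 0})"
    have F: "finite F" "l \<in> F" using * fin by (auto simp: F_def)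
    have "(\<Sum>l | J k l \<noteq> 0. smult (J k l) (Q l)) = (\<Sum>l\<in>F. smult (J k l) (Q l))"
      using F by (intro sum.mono_neutral_left) (auto simp: F_def)
    moreover have "(\<Sum>l | J' k l \<noteq> 0. smult (J' k l) (Q l)) = (\<Sum>l\<in>F. smult (J' k l) (Q l))"
      using F by (intro sum.mono_neutral_left) (auto simp: F_def)
    ultimately have "(\<Sum>l\<in>F. smult (J' k l - J k l) (Q l)) = 0"
      using * eq[of k] by (simp add: smult_diff_left sum_subtractf)
    from sum_smult_eq_0D[OF Q F(1) this F(2)] show "J' k l = J k l" by simp
  qed
qed (use fin eq in blast)

section \<open>Step-line exponents and the recurrence\<close>

locale jacobi_pineiro_steps = jacobi_exponent +
  fixes \<alpha> \<beta> :: real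
  assumes alpha: "\<alpha> > -1" and beta: "\<beta> > -1"
    and neq: "\<alpha> \<noteq> \<beta>" and close: "\<bar>\<alpha> - \<beta>\<bar> < 1"
begin

text \<open>Lists the exponents in the order in which the step-line adds the orthogonality
  conditions.\<close>

definition a :: "nat \<Rightarrow> real" where
  "a k = (if even k then \<alpha> else \<beta>) + real (k div 2)"

lemma a_gt: "a k > -1"
  using alpha beta by (auto simp: a_def)

lemma a_add_2: "a (Suc (Suc k)) = 1 + a k"
  by (simp add: a_def)

text \<open>Exponents of different parity cannot meet because \<alpha> - \<beta> is not an
  integer.\<close>

lemma inj_a: "inj a"
proof (rule injI)
  fix i j assume eq: "a i = a j"
  have parity: "even i \<longleftrightarrow> even j"
  proof (rule ccontr)
    assume "even i \<noteq> even j"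
    hence "\<bar>\<alpha> - \<beta>\<bar> = \<bar>of_int (int (i div 2) - int (j div 2))\<bar>"
      using eq by (auto simp: a_def split: if_splits)
    moreover from this have "real_of_int \<bar>int (i div 2) - int (j div 2)\<bar> < 1"
      using close by simp
    hence "\<bar>int (i div 2) - int (j div 2)\<bar> < 1"
      by (simp only: of_int_less_1_iff)
    hence "int (i div 2) - int (j div 2) = 0"
      by linarith
    ultimately show False using neq by simp
  qed
  hence "i div 2 = j div 2"
    using eq by (auto simp: a_def split: if_splits)
  with parity show "i = j"
    by (metis even_two_times_div_two odd_two_times_div_two_succ)
qed

lemma a_eq_iff [simp]: "a i = a j \<longleftrightarrow> i = j"
  using inj_a by (auto dest: injD)

text \<open>From index 2 on, \<open>k div 2\<close> contributes at least 1, which exceeds the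
  distance of \<alpha> and \<beta>. The order of \<open>a 0\<close> and \<open>a 1\<close> remains
  open.\<close>

lemma a_0_less: "k \<ge> 2 \<Longrightarrow> a 0 < a k"
proof -
  assume "k \<ge> 2"
  hence "k div 2 \<ge> 1" by linarith
  hence "real (k div 2) \<ge> 1" by simp
  thus ?thesis using close by (auto simp: a_def)
qed

lemma a_1_less: "k \<ge> 2 \<Longrightarrow> a 1 < a k"
proof -
  assume "k \<ge> 2"
  hence "k div 2 \<ge> 1" by linarith
  hence "real (k div 2) \<ge> 1" by simp
  thus ?thesis using close by (auto simp: a_def)
qed

definition window :: "nat \<Rightarrow> nat \<Rightarrow> real set" where
  "window i k = a ` {i..<i + k}"

lemma exponents_window: "exponents (window i k)"
  using a_gt by (auto simp: exponents_def window_def)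

lemma card_window: "card (window i k) = k"
  using inj_a by (simp add: window_def card_image inj_on_subset)

lemma window_Suc: "window i (Suc k) = insert (a (i + k)) (window i k)"
  by (auto simp: window_def less_Suc_eq)

lemma window_Suc_left: "window i (Suc k) = insert (a i) (window (Suc i) k)"
proof -
  have "{i..<i + Suc k} = insert i {Suc i..<Suc i + k}" by auto
  thus ?thesis by (simp add: window_def)
qed

text \<open>Links a slide by two places to the exponent shift caused by a factor
  \<open>x\<close>.\<close>

lemma window_add_2: "window (Suc (Suc i)) k = (+) 1 ` window i k"
proof -
  have "{Suc (Suc i)..<Suc (Suc i) + k} = (\<lambda>j. Suc (Suc j)) ` {i..<i + k}"
    using image_Suc_atLeastLessThan by (simp flip: image_image[of Suc Suc])
  thus ?thesis by (simp add: window_def image_image a_add_2)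
qed

lemma a_mem_window: "a j \<in> window i k \<longleftrightarrow> i \<le> j \<and> j < i + k"
  by (auto simp: window_def)

definition B :: "nat \<Rightarrow> nat \<Rightarrow> real poly" where
  "B i k = (THE p. mop (window i k) p)"

lemma mop_B: "mop (window i k) (B i k)"
proof -
  have "\<exists>!p. mop (window i k) p"
    by (rule ex_ex1I[OF mop_exists mop_unique]) (rule exponents_window)+
  thus ?thesis
    unfolding B_def by (rule theI')
qed

text \<open>The two windows share all exponents but the outermost ones, which the hypothesis
  compares.\<close>

lemma B_replace:
  assumes "a i < a (i + Suc k)"
  shows "\<exists>l\<ge>0. B i (Suc k) = B (Suc i) (Suc k) + smult l (B (Suc i) k)"
proof (rule mop_replace[OF exponents_window _ _ a_gt assms])
  show "mop (insert (a i) (window (Suc i) k)) (B i (Suc k))"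
    using mop_B[of i "Suc k"] by (simp add: window_Suc_left)
  show "mop (insert (a (i + Suc k)) (window (Suc i) k)) (B (Suc i) (Suc k))"
    using mop_B[of "Suc i" "Suc k"] by (simp add: window_Suc)
qed (auto simp: a_mem_window mop_B)

lemma B_mult_x:
  "\<exists>u\<ge>0. pCons 0 (B (Suc (Suc i)) k) = B i (Suc k) + smult u (B i k)"
proof (rule mop_mult_x[OF exponents_window])
  show "mop ((+) 1 ` window i k) (B (Suc (Suc i)) k)"
    using mop_B[of "Suc (Suc i)" k] by (simp add: window_add_2)
  show "mop (insert (a (i + k)) (window i k)) (B i (Suc k))"
    using mop_B[of i "Suc k"] by (simp add: window_Suc)
qed (auto simp: a_mem_window mop_B a_gt)

text \<open>For \<open>k < 2\<close> the truncated differences \<open>k - 1\<close> and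
  \<open>k - 2\<close> may repeat the index 0; the corresponding coefficients are therefore required
  to vanish.\<close>

lemma B_row:
  "\<exists>c0 c1 c2. c0 \<ge> 0 \<and> c1 \<ge> 0 \<and> c2 \<ge> 0 \<and> (k < 1 \<longrightarrow> c1 = 0) \<and> (k < 2 \<longrightarrow> c2 = 0) \<and>
     pCons 0 (B 0 k) = B 0 (Suc k) + smult c0 (B 0 k) + smult c1 (B 0 (k - 1)) + smult c2 (B 0 (k - 2))"
proof -
  obtain u where u: "\<And>k. u k \<ge> 0"
    "\<And>k. pCons 0 (B 2 k) = B 0 (Suc k) + smult (u k) (B 0 k)"
    using B_mult_x[of 0] by (simp flip: numeral_2_eq_2) metis
  consider "k = 0" | "k = 1" | j where "k = Suc (Suc j)"
    by (metis One_nat_def not0_implies_Suc)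
  thus ?thesis
  proof cases
    case 1
    have "B 0 0 = B 2 0"
      using mop_B[of 0 0] mop_B[of 2 0] mop_unique[OF exponents_window, of 0 0]
      by (simp add: window_def)
    thus ?thesis
      using u(1)[of 0] u(2)[of 0] 1
      by (intro exI[of _ "u 0"] exI[of _ 0]) simp
  next
    case 2
    txt \<open>Here \<open>B_replace\<close> is of no use, since \<open>a 1 < a 0\<close> is possible; instead the exponent
      \<open>a 0\<close> is replaced by \<open>a 2\<close> in a single step.\<close>
    have "\<exists>l\<ge>0. B 0 1 = B 2 1 + smult l (B 2 0)"
    proof (rule mop_replace[of "{}" "a 0" "a 2"])
      have "{2..<3} = {2::nat}" by auto
      thus "mop (insert (a 0) {}) (B 0 1)" "mop (insert (a 2) {}) (B 2 1)" "mop {} (B 2 0)"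
        using mop_B[of 0 1] mop_B[of 2 1] mop_B[of 2 0] by (simp_all add: window_def)
    qed (use a_gt a_0_less in \<open>auto simp: exponents_def\<close>)
    then obtain l where l: "l \<ge> 0" "B 0 1 = B 2 1 + smult l (B 2 0)" by blast
    have "pCons 0 (B 0 1) = pCons 0 (B 2 1) + smult l (pCons 0 (B 2 0))"
      by (subst l(2)) simp
    also have "\<dots> = B 0 (Suc 1) + smult (u 1 + l) (B 0 1) + smult (l * u 0) (B 0 0)"
      by (simp only: u(2)) (simp add: smult_add_left smult_add_right)
    finally show ?thesis
      using u(1)[of 0] u(1)[of 1] l(1) 2
      by (intro exI[of _ "u 1 + l"] exI[of _ "l * u 0"] exI[of _ 0]) simp
  next
    case 3
    \<comment> \<open>Two slides lead from start 0 to start 2; the third equation treats the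
      lower-degree term left by the first slide. The exponents compared are
      \<open>a 0 < a k\<close>, \<open>a 1 < a (Suc k)\<close> and \<open>a 1 < a k\<close>, with
      larger index at least 2.\<close>
    obtain l where l: "l \<ge> 0" "B 0 k = B 1 k + smult l (B 1 (Suc j))"
      using B_replace[of 0 "Suc j"] a_0_less[of k] 3 by auto
    obtain l' where l': "l' \<ge> 0" "B 1 k = B 2 k + smult l' (B 2 (Suc j))"
      using B_replace[of 1 "Suc j"] a_1_less[of "Suc k"] 3 by (auto simp: numeral_2_eq_2)
    obtain l'' where l'': "l'' \<ge> 0" "B 1 (Suc j) = B 2 (Suc j) + smult l'' (B 2 j)"
      using B_replace[of 1 j] a_1_less[of k] 3 by (auto simp: numeral_2_eq_2)
    have "pCons 0 (B 0 k) = pCons 0 (B 2 k) + smult (l + l') (pCons 0 (B 2 (Suc j))) +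
            smult (l * l'') (pCons 0 (B 2 j))"
      unfolding l(2) l'(2) l''(2) by (simp add: smult_add_left smult_add_right algebra_simps)
    also have "\<dots> = B 0 (Suc k) + smult (u k + (l + l')) (B 0 k) +
        smult ((l + l') * u (Suc j) + l * l'') (B 0 (Suc j)) + smult (l * l'' * u j) (B 0 j)"
      by (simp add: u(2) smult_add_left smult_add_right algebra_simps 3)
    finally show ?thesis
      using u(1)[of k] u(1)[of "Suc j"] u(1)[of j] l(1) l'(1) l''(1) 3
      by (intro exI[of _ "u k + (l + l')"] exI[of _ "(l + l') * u (Suc j) + l * l''"]
          exI[of _ "l * l'' * u j"]) simp
  qed
qed

section \<open>Transfer to the Jacobi matrix and the stochastic matrix\<close>

text \<open>The even indices below \<open>k\<close> give the conditions for \<alpha>, the odd ones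
  those for \<beta>.\<close>

lemma is_jacobi_pineiro_iff_mop:
  "is_jacobi_pineiro \<alpha> \<beta> \<gamma> ((k + 1) div 2) (k div 2) p \<longleftrightarrow> mop (window 0 k) p"
proof -
  have "(\<forall>s\<in>window 0 k. jacobi_integral p s 0) \<longleftrightarrow> (\<forall>i<k. jacobi_integral p (a i) 0)"
    by (auto simp: window_def)
  also have "\<dots> \<longleftrightarrow> (\<forall>j<(k + 1) div 2. jacobi_integral p (\<alpha> + real j) 0) \<and>
                  (\<forall>j<k div 2. jacobi_integral p (\<beta> + real j) 0)" (is "?L \<longleftrightarrow> ?R")
  proof
    assume L: ?L
    have "jacobi_integral p (\<alpha> + real j) 0" if "j < (k + 1) div 2" for j
      using L[rule_format, of "2 * j"] that by (simp add: a_def)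
    moreover have "jacobi_integral p (\<beta> + real j) 0" if "j < k div 2" for j
      using L[rule_format, of "2 * j + 1"] that by (simp add: a_def)
    ultimately show ?R by blast
  next
    assume R: ?R
    show ?L
    proof (intro allI impI)
      fix i assume "i < k"
      show "jacobi_integral p (a i) 0"
      proof (cases "even i")
        case True
        hence "i div 2 < (k + 1) div 2" using \<open>i < k\<close> by auto
        thus ?thesis using R True by (simp add: a_def)
      next
        case False
        hence "i div 2 < k div 2" using \<open>i < k\<close> by (auto elim!: oddE)
        thus ?thesis using R False by (simp add: a_def)
      qed
    qed
  qed
  finally have "(\<forall>s\<in>window 0 k. jacobi_integral p s 0) \<longleftrightarrow> ?R" .
  moreover have "(k + 1) div 2 + k div 2 = k" by presburger
  ultimately show ?thesis
    unfolding is_jacobi_pineiro_def mop_def card_window jacobi_integral_def by auto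
qed

lemma jacobi_pineiro_step_eq: "jacobi_pineiro_step \<alpha> \<beta> \<gamma> k = B 0 k"
  by (simp only: jacobi_pineiro_step_def jacobi_pineiro_def is_jacobi_pineiro_iff_mop B_def)

lemma jacobi_matrix_step:
  defines "Q \<equiv> jacobi_pineiro_step \<alpha> \<beta> \<gamma>"
  defines "J \<equiv> jacobi_matrix Q"
  shows "J k l \<ge> 0"
    and "J k (Suc k) = 1"
    and "\<not> (k \<le> l + 2 \<and> l \<le> k + 1) \<Longrightarrow> J k l = 0"
    and "[:0, 1:] * Q k = (\<Sum>l\<le>Suc k. smult (J k l) (Q l))"
proof -
  have Q: "Q = B 0"
    by (simp add: Q_def jacobi_pineiro_step_eq fun_eq_iff)
  obtain c0 c1 c2 where c: "\<And>k. c0 k \<ge> 0" "\<And>k. c1 k \<ge> 0" "\<And>k. c2 k \<ge> 0"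
    "\<And>k. k < 1 \<Longrightarrow> c1 k = 0" "\<And>k. k < 2 \<Longrightarrow> c2 k = 0"
    "\<And>k. pCons 0 (Q k) = Q (Suc k) + smult (c0 k) (Q k) + smult (c1 k) (Q (k - 1)) +
       smult (c2 k) (Q (k - 2))"
    unfolding Q using B_row by metis
  \<comment> \<open>The subdiagonals are tested by \<open>Suc l = k\<close> and
    \<open>Suc (Suc l) = k\<close>, so truncated subtraction creates no entries in the first two
    rows.\<close>
  define K where "K = (\<lambda>k l. if l = Suc k then 1 else if l = k then c0 k
    else if Suc l = k then c1 k else if Suc (Suc l) = k then c2 k else 0)"
  have K_sum: "pCons 0 (Q k) = (\<Sum>l\<le>Suc k. smult (K k l) (Q l))" for k
  proof -
    consider "k = 0" | "k = 1" | j where "k = Suc (Suc j)"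
      by (metis One_nat_def not0_implies_Suc)
    thus ?thesis
    proof cases
      case 3
      have "(\<Sum>l<j. smult (K k l) (Q l)) = 0"
        by (intro sum.neutral) (auto simp: K_def 3)
      moreover have "{..j} = insert j {..<j}" by auto
      ultimately show ?thesis
        by (subst c(6)) (simp add: 3 K_def)
    next
      case 1
      show ?thesis
        by (subst c(6)) (simp add: 1 K_def c(4,5))
    next
      case 2
      show ?thesis
        by (subst c(6)) (simp add: 2 K_def c(5))
    qed
  qed
  have K_fin: "{l. K k l \<noteq> 0} \<subseteq> {..Suc k}" for k
    by (auto simp: K_def split: if_splits)
  have "J = K"
    unfolding J_def
  proof (rule jacobi_matrix_eqI)
    fix k
    show deg: "degree (Q k) = k" for k
      using mop_B[of 0 k] by (simp add: Q mop_def card_window)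
    show "Q k \<noteq> 0"
      using mop_B[of 0 k] by (auto simp: Q mop_def)
    show fin: "finite {l. K k l \<noteq> 0}"
      using K_fin finite_subset by blast
    have "(\<Sum>l | K k l \<noteq> 0. smult (K k l) (Q l)) = (\<Sum>l\<le>Suc k. smult (K k l) (Q l))"
      using K_fin by (intro sum.mono_neutral_left) auto
    thus "[:0, 1:] * Q k = (\<Sum>l | K k l \<noteq> 0. smult (K k l) (Q l))"
      using K_sum[of k] by simp
  qed
  show "J k l \<ge> 0"
    using c(1-3) by (simp add: \<open>J = K\<close> K_def)
  show "J k (Suc k) = 1"
    by (simp add: \<open>J = K\<close> K_def)
  show "\<not> (k \<le> l + 2 \<and> l \<le> k + 1) \<Longrightarrow> J k l = 0"
    by (auto simp: \<open>J = K\<close> K_def)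
  show "[:0, 1:] * Q k = (\<Sum>l\<le>Suc k. smult (J k l) (Q l))"
    using K_sum[of k] by (simp add: \<open>J = K\<close>)
qed

lemma jacobi_pineiro_step_1_pos: "poly (jacobi_pineiro_step \<alpha> \<beta> \<gamma> k) 1 > 0"
  unfolding jacobi_pineiro_step_eq using mop_eval_1_pos[OF exponents_window mop_B] .

text \<open>The matrix \<open>P\<close> is \<open>J\<close> conjugated by the diagonal matrix of the values at \<open>1\<close>, and its
  row sums are the recurrence relation evaluated at \<open>1\<close>.\<close>
lemma multiple_stochastic_conjugate:
  fixes P
  defines "Q \<equiv> jacobi_pineiro_step \<alpha> \<beta> \<gamma>"
  assumes P: "\<And>k l. P k l = poly (Q l) 1 / poly (Q k) 1 * jacobi_matrix Q k l"
  shows "multiple_stochastic_II P"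
  unfolding multiple_stochastic_II_def
proof (intro conjI allI impI)
  fix k l
  show "0 \<le> P k l"
    using jacobi_pineiro_step_1_pos[of k] jacobi_pineiro_step_1_pos[of l] jacobi_matrix_step(1)
    by (simp add: P Q_def)
  show band: "\<not> (k \<le> l + 2 \<and> l \<le> k + 1) \<Longrightarrow> P k l = 0" for k l
    using jacobi_matrix_step(3) by (simp add: P Q_def)
  have "(\<Sum>l\<le>Suc k. P k l) = (\<Sum>l\<le>Suc k. jacobi_matrix Q k l * poly (Q l) 1) / poly (Q k) 1"
    unfolding sum_divide_distrib by (intro sum.cong) (auto simp: P)
  also have "(\<Sum>l\<le>Suc k. jacobi_matrix Q k l * poly (Q l) 1) = poly ([:0, 1:] * Q k) 1"
    unfolding Q_def by (subst jacobi_matrix_step(4)) (simp add: poly_sum)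
  finally have "(\<Sum>l\<le>Suc k. P k l) = 1"
    using jacobi_pineiro_step_1_pos[of k] by (simp add: Q_def)
  moreover have "P k sums (\<Sum>l\<le>Suc k. P k l)"
    by (intro sums_finite) (auto intro!: band)
  ultimately show "P k sums 1" by simp
qed

end

theorem theorem11:
  fixes \<alpha> \<beta> \<gamma> :: real
    and B :: "nat \<Rightarrow> nat \<Rightarrow> real poly"
    and J P :: "nat \<Rightarrow> nat \<Rightarrow> real"
  assumes "\<alpha> > -1" and "\<beta> > -1" and "\<gamma> > -1"
    and "\<alpha> \<noteq> \<beta>" and "\<bar>\<alpha> - \<beta>\<bar> < 1"
    and "B = jacobi_pineiro \<alpha> \<beta> \<gamma>"
    and "J = jacobi_matrix (jacobi_pineiro_step \<alpha> \<beta> \<gamma>)"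
    and "\<And>k l. \<not> (k \<le> l + 2 \<and> l \<le> k + 1) \<Longrightarrow> P k l = 0"
    and "\<And>n. P (2*n) (2*n+1) = poly (B (n+1) n) 1 / poly (B n n) 1"
    and "\<And>n. P (2*n+1) (2*n+2) = poly (B (n+1) (n+1)) 1 / poly (B (n+1) n) 1"
    and "\<And>n. P (2*n) (2*n) = J (2*n) (2*n)"
    and "\<And>n. P (2*n+1) (2*n+1) = J (2*n+1) (2*n+1)"
    and "\<And>n. P (2*n+2) (2*n+1) =
           poly (B (n+1) n) 1 / poly (B (n+1) (n+1)) 1 * J (2*n+2) (2*n+1)"
    and "\<And>n. P (2*n+1) (2*n) =
           poly (B n n) 1 / poly (B (n+1) n) 1 * J (2*n+1) (2*n)"
    and "\<And>n. P (2*n+2) (2*n) =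
           poly (B n n) 1 / poly (B (n+1) (n+1)) 1 * J (2*n+2) (2*n)"
    and "\<And>n. P (2*n+3) (2*n+1) =
           poly (B (n+1) n) 1 / poly (B (n+2) (n+1)) 1 * J (2*n+3) (2*n+1)"
  shows "multiple_stochastic_II P"
proof -
  interpret jacobi_pineiro_steps \<gamma> \<alpha> \<beta>
    by unfold_locales (use assms in auto)
  let ?Q = "jacobi_pineiro_step \<alpha> \<beta> \<gamma>"
  have B: "jacobi_pineiro \<alpha> \<beta> \<gamma> n n = ?Q (2*n)" "jacobi_pineiro \<alpha> \<beta> \<gamma> (Suc n) n = ?Q (2*n+1)" for n
    by (simp_all add: jacobi_pineiro_step_def)
  \<comment> \<open>All indices are brought to \<open>Suc\<close> form and all polynomials to the
    step-line, so that the entries of \<open>P\<close> serve as rewrite rules.\<close>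
  note P = assms(9-16)[unfolded assms(6) numeral_3_eq_3 Suc_eq_plus1[symmetric] add_2_eq_Suc'
      add_Suc_right add_0_right B]
  have pos: "poly (?Q k) 1 \<noteq> 0" for k
    using jacobi_pineiro_step_1_pos[of k] by simp
  have one: "J k (Suc k) = 1" for k
    using jacobi_matrix_step(2) assms(7) by simp
  \<comment> \<open>One formula covers all prescribed entries: the superdiagonal because
    \<open>J\<close> is 1 there, the diagonal because the quotient of values cancels.\<close>
  have "P k l = poly (?Q l) 1 / poly (?Q k) 1 * J k l" for k l
  proof (cases "k \<le> l + 2 \<and> l \<le> k + 1")
    case False
    thus ?thesis
      using jacobi_matrix_step(3)[of k l] assms(8)[of k l] by (simp add: assms(7))
  next
    case True
    then consider "l = Suc k" | "l = k" | "k = Suc l" | "k = Suc (Suc l)"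
      by linarith
    thus ?thesis
    proof cases
      case 1
      show ?thesis
        by (cases "even k") (auto elim!: evenE oddE simp: 1 one P)
    next
      case 2
      show ?thesis
        by (cases "even k") (auto elim!: evenE oddE simp: 2 P pos)
    next
      case 3
      show ?thesis
        by (cases "even l") (auto elim!: evenE oddE simp: 3 P)
    next
      case 4
      show ?thesis
        by (cases "even l") (auto elim!: evenE oddE simp: 4 P)
    qed
  qed
  thus ?thesis
    unfolding assms(7) by (rule multiple_stochastic_conjugate)
qed

end
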